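(* Let $n\ge 1$ and let $T:\mathbb{H}^n\rightrightarrows V_1$ be a maximal H-monotone map with $\mathrm{dom}(T)=\mathbb{H}^n$. Then, for every $\lambda>0$, the resolvent $Q_\lambda=(\xi_1+\lambda T)^{-1}:V_1\rightrightarrows\mathbb{H}^n$, $Q_\lambda(v)=\{\eta\in\mathbb{H}^n: v\in\xi_1(\eta)+\lambda T(\eta)\}$, is $1$-Lipschitz continuous in the Hausdorff metric.
   Context: The Heisenberg group $\mathbb{H}^n$ is $\mathbb{R}^n\times\mathbb{R}^n\times\mathbb{R}$ with group law $(x,y,t)\circ(x',y',t')=(x+x',y+y',t+t'+2(\langle x',y\rangle-\langle x,y'\rangle))$, neutral element $e=0$, and metric $d_H(\eta,\eta')=N((\eta')^{-1}\circ\eta)$, where $N(x,y,t)=((\|x\|^2+\|y\|^2)^2+t^2)^{1/4}$; $B_{\mathbb{H}^n}(\eta_0,r)=\{\eta: d_H(\eta_0,\eta)\le r\}$. $V_1\cong\mathbb{R}^{2n}$ is the first (horizontal) layer of its Lie algebra, with the Euclidean inner product $\langle\cdot,\cdot\rangle$ and norm $\|\cdot\|$, and $\xi_1:\mathbb{H}^n\to V_1$ is $\xi_1(x,y,t)=(x,y)$. For $\eta_0=(x_0,y_0,t_0)\in\mathbb{H}^n$ the horizontal plane through $\eta_0$ is $H_{\eta_0}=\{(x,y,t)\in\mathbb{H}^n: t=t_0+2(\langle y_0,x\rangle-\langle x_0,y\rangle)\}$. A set-valued map $T:\mathbb{H}^n\rightrightarrows V_1$ assigns to each $\eta$ a (possibly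 empty) subset $T(\eta)\subseteq V_1$; $\mathrm{dom}(T)=\{\eta: T(\eta)\ne\emptyset\}$ and $\mathrm{gr}(T)=\{(\eta,v): v\in T(\eta)\}$. A set $A\subset\mathbb{H}^n\times V_1$ is H-monotone if $\langle \xi_1(\eta)-\xi_1(\eta'),v-v'\rangle\ge 0$ for all $(\eta,v),(\eta',v')\in A$ with $\eta'\in H_\eta$; it is maximal H-monotone if it is H-monotone and is not properly contained in any H-monotone set. $T$ is (maximal) H-monotone if $\mathrm{gr}(T)$ is a (maximal) H-monotone set. A closed-valued set-valued map $Q:V_1\rightrightarrows\mathbb{H}^n$ is $k$-Lipschitz continuous in the Hausdorff metric ($k>0$) if $Q(v)\neq\emptyset$ for every $v\in V_1$ and $Q(v')\subseteq Q(v)\circ B_{\mathbb{H}^n}(e,k\|v'-v\|)$ for all $v,v'\in V_1$, where $A\circ B=\{a\circ b: a\in A, b\in B\}$; equivalently (for the inclusion), for every $\eta'\in Q(v')$ there is $\eta\in Q(v)$ with $d_H(\eta,\eta')\le k\|v'-v\|$. *)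

theory Defs
  imports "HOL-Analysis.Analysis"
begin

text \<open>
  The dimension is \<open>n = CARD('n)\<close>, so \<open>n \<ge> 1\<close> holds automatically.  The product type
  \<open>real ^ 'n \<times> real ^ 'n\<close> carries the Euclidean inner product and norm of \<open>\<real>\<^sup>2\<^sup>n\<close>.  The library
  topology on \<^typ>\<open>(real ^ 'n) \<times> (real ^ 'n) \<times> real\<close> is the Euclidean one, which is also the
  topology of the metric \<open>heis_dist\<close> below; the library metric of that type is never used.
\<close>

type_synonym 'n heis = "(real ^ 'n) \<times> (real ^ 'n) \<times> real"
type_synonym 'n layer1 = "(real ^ 'n) \<times> (real ^ 'n)"

fun heis_mult :: "'n::finite heis \<Rightarrow> 'n heis \<Rightarrow> 'n heis" where
  "heis_mult (x, y, t) (x', y', t') =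
     (x + x', y + y', t + t' + 2 * (inner x' y - inner x y'))"

definition heis_unit :: "'n::finite heis" where
  "heis_unit = (0, 0, 0)"

fun heis_inv :: "'n::finite heis \<Rightarrow> 'n heis" where
  "heis_inv (x, y, t) = (- x, - y, - t)"

lemma heis_mult_assoc:
  "heis_mult (heis_mult a b) c = heis_mult a (heis_mult b c)"
  by (cases a; cases b; cases c) (simp add: inner_add_left inner_add_right algebra_simps)

lemma heis_unit_left [simp]: "heis_mult heis_unit a = a"
  and heis_unit_right [simp]: "heis_mult a heis_unit = a"
  by (cases a; simp add: heis_unit_def)+

lemma heis_inv_left [simp]: "heis_mult (heis_inv a) a = heis_unit"
  and heis_inv_right [simp]: "heis_mult a (heis_inv a) = heis_unit"
  by (cases a; simp add: heis_unit_def)+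

fun heis_gauge :: "'n::finite heis \<Rightarrow> real" where
  "heis_gauge (x, y, t) = root 4 (((norm x)\<^sup>2 + (norm y)\<^sup>2)\<^sup>2 + t\<^sup>2)"

definition heis_dist :: "'n::finite heis \<Rightarrow> 'n heis \<Rightarrow> real" where
  "heis_dist \<eta> \<eta>' = heis_gauge (heis_mult (heis_inv \<eta>') \<eta>)"

definition heis_cball :: "'n::finite heis \<Rightarrow> real \<Rightarrow> 'n heis set" where
  "heis_cball \<eta>0 r = {\<eta>. heis_dist \<eta>0 \<eta> \<le> r}"

definition heis_set_mult :: "'n::finite heis set \<Rightarrow> 'n heis set \<Rightarrow> 'n heis set" where
  "heis_set_mult A B = {heis_mult a b | a b. a \<in> A \<and> b \<in> B}"

fun xi1 :: "'n::finite heis \<Rightarrow> 'n layer1" where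
  "xi1 (x, y, t) = (x, y)"

fun horizontal_plane :: "'n::finite heis \<Rightarrow> 'n heis set" where
  "horizontal_plane (x0, y0, t0) =
     {(x, y, t) | x y t. t = t0 + 2 * (inner y0 x - inner x0 y)}"

definition set_map_dom :: "('a \<Rightarrow> 'b set) \<Rightarrow> 'a set" where
  "set_map_dom T = {a. T a \<noteq> {}}"

definition set_map_graph :: "('a \<Rightarrow> 'b set) \<Rightarrow> ('a \<times> 'b) set" where
  "set_map_graph T = {(a, b). b \<in> T a}"

definition H_monotone_set :: "('n::finite heis \<times> 'n layer1) set \<Rightarrow> bool" where
  "H_monotone_set A \<longleftrightarrow>
     (\<forall>(\<eta>, v) \<in> A. \<forall>(\<eta>', v') \<in> A. \<eta>' \<in> horizontal_plane \<eta> \<longrightarrow>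
        inner (xi1 \<eta> - xi1 \<eta>') (v - v') \<ge> 0)"

definition maximal_H_monotone_set :: "('n::finite heis \<times> 'n layer1) set \<Rightarrow> bool" where
  "maximal_H_monotone_set A \<longleftrightarrow>
     H_monotone_set A \<and> \<not> (\<exists>B. H_monotone_set B \<and> A \<subset> B)"

definition maximal_H_monotone :: "('n::finite heis \<Rightarrow> 'n layer1 set) \<Rightarrow> bool" where
  "maximal_H_monotone T \<longleftrightarrow> maximal_H_monotone_set (set_map_graph T)"

text \<open>Closed-valuedness is a standing requirement in the notion of Lipschitz set-valued map, so
  it is a conjunct of the definition.\<close>

definition Hausdorff_lipschitz :: "real \<Rightarrow> ('n::finite layer1 \<Rightarrow> 'n heis set) \<Rightarrow> bool" where
  "Hausdorff_lipschitz k Q \<longleftrightarrow>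
     k > 0 \<and> (\<forall>v. closed (Q v)) \<and> (\<forall>v. Q v \<noteq> {}) \<and>
     (\<forall>v v'. Q v' \<subseteq> heis_set_mult (Q v) (heis_cball heis_unit (k * norm (v' - v))))"

definition resolvent ::
    "real \<Rightarrow> ('n::finite heis \<Rightarrow> 'n layer1 set) \<Rightarrow> 'n layer1 \<Rightarrow> 'n heis set" where
  "resolvent l T v = {\<eta>. v \<in> {xi1 \<eta> + l *\<^sub>R w | w. w \<in> T \<eta>}}"

end

theory Submission
  imports Defs
begin

text \<open>
  Given \<open>r \<in> Q(v')\<close>, it suffices to find \<open>p \<in> Q(v)\<close> on the horizontal plane of \<open>r\<close>: monotonicity
  of the pair \<open>(r, p)\<close> then gives \<open>\<parallel>\<xi>\<^sub>1(r) - \<xi>\<^sub>1(p)\<parallel> \<le> \<parallel>v' - v\<parallel>\<close>, and this norm is the distance of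
  \<open>r\<close> and \<open>p\<close>.  On that plane, parametrised by \<open>V\<^sub>1\<close>, the map \<open>\<xi>\<^sub>1 + \<lambda>T - v\<close> need not be monotone,
  but monotonicity with respect to the base point \<open>r\<close> makes it coercive, so a Brouwer argument
  gives a zero as soon as \<open>T\<close> is locally separated from the vectors outside its values.
  Separation, and closedness of the resolvent, follow from maximality and local boundedness of \<open>T\<close>.
\<close>

section \<open>Zeros of coercive set-valued maps\<close>

text \<open>
  If \<open>0\<close> is not a value, the separating vectors can be glued into a continuous field \<open>b\<close> with
  \<open>b z \<bullet> w > 0\<close> for all \<open>w \<in> G z\<close>; a fixed point of the projection of \<open>z - b z\<close> contradicts this,
  since \<open>z\<close> can be moved a little in direction \<open>- w\<close> within the ball.
\<close>

lemma coercive_set_map_zero: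
  fixes G :: "'a::euclidean_space \<Rightarrow> 'a set"
  assumes R: "0 < R"
    and ne: "\<And>z. z \<in> cball c R \<Longrightarrow> G z \<noteq> {}"
    and sep: "\<And>z. z \<in> cball c R \<Longrightarrow> 0 \<notin> G z \<Longrightarrow>
                \<exists>a. \<forall>\<^sub>F z' in nhds z. \<forall>w\<in>G z'. 0 < a \<bullet> w"
    and outward: "\<And>z w. dist c z = R \<Longrightarrow> w \<in> G z \<Longrightarrow> 0 < (z - c) \<bullet> w"
  shows "\<exists>z\<in>cball c R. 0 \<in> G z"
proof (rule ccontr)
  assume none: "\<not> ?thesis"
  have "\<exists>a r. 0 < r \<and> (\<forall>z'\<in>ball z r. \<forall>w\<in>G z'. 0 < a \<bullet> w)" if "z \<in> cball c R" for z
    using sep[OF that] none that unfolding eventually_nhds_metric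
    by (metis dist_commute mem_ball)
  then obtain a r where r: "\<And>z. z \<in> cball c R \<Longrightarrow> 0 < r z"
    and a: "\<And>z z' w. z \<in> cball c R \<Longrightarrow> z' \<in> ball z (r z) \<Longrightarrow> w \<in> G z' \<Longrightarrow> 0 < a z \<bullet> w"
    by metis
  have cover: "cball c R \<subseteq> (\<Union>z\<in>cball c R. ball z (r z))"
    using r by (meson UN_I centre_in_ball subsetI)
  obtain S where S: "S \<subseteq> cball c R" "finite S" "cball c R \<subseteq> (\<Union>z\<in>S. ball z (r z))"
    using compactE_image[OF compact_cball _ cover] by (metis open_ball)
  \<comment> \<open>Each weight vanishes outside the ball on which its separating vector works, so
    only vectors positive on \<open>G z\<close> contribute to \<open>b z\<close>.\<close>
  define b where "b z = (\<Sum>s\<in>S. max 0 (r s - dist s z) *\<^sub>R a s)" for z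
  have b_pos: "0 < b z \<bullet> w" if z: "z \<in> cball c R" and w: "w \<in> G z" for z w
  proof -
    have nonneg: "0 \<le> max 0 (r s - dist s z) * (a s \<bullet> w)" if "s \<in> S" for s
    proof (cases "dist s z < r s")
      case True
      then show ?thesis using a[of s z w] that S(1) w by (auto intro!: mult_nonneg_nonneg less_imp_le)
    qed auto
    obtain s where s: "s \<in> S" "dist s z < r s" using S(3) z by auto
    have "0 < max 0 (r s - dist s z) * (a s \<bullet> w)"
      using a[of s z w] s S(1) w by (auto intro!: mult_pos_pos)
    then show ?thesis
      unfolding b_def inner_sum_left inner_scaleR_left
      using nonneg s(1) S(2) by (intro sum_pos2) auto
  qed
  have "continuous_on (cball c R) (closest_point (cball c R) \<circ> (\<lambda>z. z - b z))"
    unfolding b_def using R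
    by (intro continuous_on_compose continuous_on_closest_point continuous_intros) auto
  moreover have "closest_point (cball c R) ` UNIV \<subseteq> cball c R"
    using R by (auto intro!: closest_point_in_set)
  ultimately obtain z where z: "z \<in> cball c R" and fix_z: "closest_point (cball c R) (z - b z) = z"
    using brouwer[of "cball c R" "closest_point (cball c R) \<circ> (\<lambda>z. z - b z)"] R
    by (auto simp: image_subset_iff Pi_iff)
  obtain w where w: "w \<in> G z" using ne z by blast
  \<comment> \<open>Variational inequality of the projection: \<open>z\<close> is the point of the
    ball nearest to \<open>z - b z\<close>.\<close>
  have var: "0 \<le> b z \<bullet> (x - z)" if "x \<in> cball c R" for x
    using closest_point_dot[of "cball c R" x "z - b z"] that fix_z by auto
  have "\<exists>\<delta>>0. z - \<delta> *\<^sub>R w \<in> cball c R"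
  proof (cases "dist c z = R")
    case True
    have pos: "0 < (z - c) \<bullet> w" using outward True w .
    \<comment> \<open>The distance to \<open>c\<close> is least at step
      \<open>(z - c) \<bullet> w / (norm w)\<^sup>2\<close>; the added 1 only shortens the step and
      keeps the denominator positive.\<close>
    define \<delta> where "\<delta> = (z - c) \<bullet> w / (1 + (norm w)\<^sup>2)"
    have d: "0 < \<delta>" unfolding \<delta>_def using pos by (simp add: add_pos_nonneg)
    have "(norm (z - c - \<delta> *\<^sub>R w))\<^sup>2 = (norm (z - c))\<^sup>2 - 2 * \<delta> * ((z - c) \<bullet> w) + \<delta> * (\<delta> * (norm w)\<^sup>2)"
      unfolding power2_norm_eq_inner by (simp add: inner_diff_left inner_diff_right inner_commute algebra_simps)
    moreover have "\<delta> * (\<delta> * (norm w)\<^sup>2) \<le> \<delta> * ((z - c) \<bullet> w)"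
    proof -
      have "\<delta> * (1 + (norm w)\<^sup>2) = (z - c) \<bullet> w"
        unfolding \<delta>_def by (simp add: add_nonneg_eq_0_iff)
      then show ?thesis using d by (intro mult_left_mono) (auto simp: algebra_simps)
    qed
    moreover have "0 < \<delta> * ((z - c) \<bullet> w)" using d pos by (rule mult_pos_pos)
    ultimately have "(norm (z - c - \<delta> *\<^sub>R w))\<^sup>2 \<le> (norm (z - c))\<^sup>2" by linarith
    then have "norm (z - c - \<delta> *\<^sub>R w) \<le> norm (z - c)"
      by (simp add: power2_le_iff_abs_le)
    then show ?thesis using d True
      by (intro exI[of _ \<delta>]) (simp add: dist_norm norm_minus_commute algebra_simps)
  next
    case False
    then have "z \<in> ball c R" using z by simp
    then obtain e where e: "0 < e" "ball z e \<subseteq> cball c R"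
      by (meson ball_subset_cball openE open_ball order_trans)
    define \<delta> where "\<delta> = e / (1 + norm w)"
    have d: "0 < \<delta>" unfolding \<delta>_def using e by (simp add: add_pos_nonneg)
    have "\<delta> * (1 + norm w) = e"
      unfolding \<delta>_def by (simp add: add_nonneg_eq_0_iff)
    then have "\<delta> * norm w < e" using d by (simp add: algebra_simps)
    then have "z - \<delta> *\<^sub>R w \<in> ball z e" using d by (simp add: dist_norm)
    then show ?thesis using d e by blast
  qed
  then obtain \<delta> where "0 < \<delta>" "z - \<delta> *\<^sub>R w \<in> cball c R" by blast
  then have "\<delta> * (b z \<bullet> w) \<le> 0" using var[of "z - \<delta> *\<^sub>R w"] by (simp add: inner_diff_right)
  then show False using b_pos[OF z w] \<open>0 < \<delta>\<close> by (simp add: mult_le_0_iff)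
qed

section \<open>The Heisenberg group as \<open>V_1\<close> times height\<close>

text \<open>The symplectic form on \<open>V_1\<close>: twice it is both the cocycle of the group law
  and the slope of the horizontal planes.\<close>

definition symp :: "'n::finite layer1 \<Rightarrow> 'n layer1 \<Rightarrow> real" where
  "symp a b = snd a \<bullet> fst b - fst a \<bullet> snd b"

text \<open>The complex structure belonging to \<open>symp\<close>: for \<open>a \<noteq> 0\<close>,
  adding multiples of \<open>rot a\<close> to a vector gives \<open>symp a\<close> any prescribed
  value.\<close>

definition rot :: "'n::finite layer1 \<Rightarrow> 'n layer1" where
  "rot a = (snd a, - fst a)"

definition point :: "'n::finite layer1 \<Rightarrow> real \<Rightarrow> 'n heis" where
  "point z t = (fst z, snd z, t)"

definition height :: "'n::finite heis \<Rightarrow> real" where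
  "height p = snd (snd p)"

lemma symp_linear [simp]:
  "symp (a + b) c = symp a c + symp b c" "symp a (b + c) = symp a b + symp a c"
  "symp (a - b) c = symp a c - symp b c" "symp a (b - c) = symp a b - symp a c"
  "symp (k *\<^sub>R a) c = k * symp a c" "symp a (k *\<^sub>R c) = k * symp a c"
  by (simp_all add: symp_def inner_simps algebra_simps)

lemma symp_self [simp]: "symp a a = 0"
  by (simp add: symp_def inner_commute)

lemma symp_swap: "symp b a = - symp a b"
  by (simp add: symp_def inner_commute)

lemma symp_rot [simp]: "symp a (rot a) = (norm a)\<^sup>2"
  by (simp add: symp_def rot_def power2_norm_eq_inner inner_prod_def)

lemma xi1_eq: "xi1 p = (fst p, fst (snd p))"
  by (cases p) simp

lemma xi1_point [simp]: "xi1 (point z t) = z" "height (point z t) = t"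
  by (simp_all add: point_def height_def)

lemma point_xi1 [simp]: "point (xi1 p) (height p) = p"
  by (simp add: point_def height_def xi1_eq)

lemma horizontal_plane_iff:
  "q \<in> horizontal_plane p \<longleftrightarrow> height q = height p + 2 * symp (xi1 p) (xi1 q)"
  by (cases p; cases q) (auto simp: symp_def height_def)

lemma horizontal_plane_sym: "q \<in> horizontal_plane p \<longleftrightarrow> p \<in> horizontal_plane q"
  using symp_swap[of "xi1 p" "xi1 q"] by (auto simp: horizontal_plane_iff)

lemma xi1_mult [simp]: "xi1 (heis_mult p q) = xi1 p + xi1 q"
  by (cases p; cases q) simp

lemma height_mult [simp]:
  "height (heis_mult p q) = height p + height q + 2 * symp (xi1 p) (xi1 q)"
  by (cases p; cases q) (simp add: symp_def height_def inner_commute)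

lemma xi1_inv [simp]: "xi1 (heis_inv p) = - xi1 p"
  and height_inv [simp]: "height (heis_inv p) = - height p"
  by (cases p; simp add: height_def)+

lemma heis_gauge_eq: "heis_gauge p = root 4 ((norm (xi1 p)) ^ 4 + (height p)\<^sup>2)"
proof -
  have "(norm (fst p))\<^sup>2 + (norm (fst (snd p)))\<^sup>2 = (norm (xi1 p))\<^sup>2"
    by (simp add: xi1_eq power2_norm_eq_inner inner_prod_def)
  then show ?thesis by (cases p) (simp add: height_def)
qed

text \<open>Left translations respect horizontality, so local statements can be moved to the
  unit.\<close>

lemma horizontal_plane_mult [simp]:
  "heis_mult r q \<in> horizontal_plane (heis_mult r p) \<longleftrightarrow> q \<in> horizontal_plane p"
  using symp_swap[of "xi1 r" "xi1 p"] by (auto simp: horizontal_plane_iff)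

lemma tendsto_symp [tendsto_intros]:
  "(f \<longlongrightarrow> a) F \<Longrightarrow> (g \<longlongrightarrow> b) F \<Longrightarrow> ((\<lambda>x. symp (f x) (g x)) \<longlongrightarrow> symp a b) F"
  unfolding symp_def by (intro tendsto_intros)

lemma tendsto_rot [tendsto_intros]: "(f \<longlongrightarrow> a) F \<Longrightarrow> ((\<lambda>x. rot (f x)) \<longlongrightarrow> rot a) F"
  unfolding rot_def by (intro tendsto_intros)

lemma tendsto_point [tendsto_intros]:
  "(f \<longlongrightarrow> a) F \<Longrightarrow> (g \<longlongrightarrow> b) F \<Longrightarrow> ((\<lambda>x. point (f x) (g x)) \<longlongrightarrow> point a b) F"
  unfolding point_def by (intro tendsto_intros)

lemma tendsto_xi1 [tendsto_intros]: "(f \<longlongrightarrow> a) F \<Longrightarrow> ((\<lambda>x. xi1 (f x)) \<longlongrightarrow> xi1 a) F"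
  unfolding xi1_eq by (intro tendsto_intros)

lemma tendsto_height [tendsto_intros]: "(f \<longlongrightarrow> a) F \<Longrightarrow> ((\<lambda>x. height (f x)) \<longlongrightarrow> height a) F"
  unfolding height_def by (intro tendsto_intros)

lemma heis_mult_eq_point:
  "heis_mult p q = point (xi1 p + xi1 q) (height p + height q + 2 * symp (xi1 p) (xi1 q))"
  by (metis height_mult point_xi1 xi1_mult)

section \<open>Monotonicity and maximality in pointwise form\<close>

lemma H_monotoneD:
  assumes "H_monotone_set (set_map_graph T)" "v \<in> T p" "w \<in> T q" "q \<in> horizontal_plane p"
  shows "0 \<le> (xi1 p - xi1 q) \<bullet> (v - w)"
  using assms unfolding H_monotone_set_def set_map_graph_def by blast

text \<open>Otherwise \<open>(p, v)\<close> could be added to the graph: horizontality is symmetric,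
  so the test against pairs from the graph covers both orders.\<close>

lemma maximal_H_monotoneI:
  assumes "maximal_H_monotone T"
    and "\<And>q w. q \<in> horizontal_plane p \<Longrightarrow> w \<in> T q \<Longrightarrow> 0 \<le> (xi1 p - xi1 q) \<bullet> (v - w)"
  shows "v \<in> T p"
proof (rule ccontr)
  assume "v \<notin> T p"
  then have "set_map_graph T \<subset> insert (p, v) (set_map_graph T)"
    by (auto simp: set_map_graph_def)
  moreover have "H_monotone_set (insert (p, v) (set_map_graph T))"
    unfolding H_monotone_set_def
  proof (clarify)
    fix q w q' w'
    assume 1: "(q, w) \<in> insert (p, v) (set_map_graph T)"
      and 2: "(q', w') \<in> insert (p, v) (set_map_graph T)" and h: "q' \<in> horizontal_plane q"
    have mono: "H_monotone_set (set_map_graph T)"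
      using assms(1) by (simp add: maximal_H_monotone_def maximal_H_monotone_set_def)
    have eq: "(xi1 q - xi1 q') \<bullet> (w - w') = (xi1 q' - xi1 q) \<bullet> (w' - w)"
      by (simp add: inner_diff_left inner_diff_right)
    consider "(q, w) = (p, v)" "(q', w') = (p, v)" | "(q, w) = (p, v)" "w' \<in> T q'"
      | "w \<in> T q" "(q', w') = (p, v)" | "w \<in> T q" "w' \<in> T q'"
      using 1 2 by (auto simp: set_map_graph_def)
    then show "0 \<le> (xi1 q - xi1 q') \<bullet> (w - w')"
    proof cases
      case 2
      then show ?thesis using assms(2) h by auto
    next
      case 3
      then show ?thesis using assms(2) h horizontal_plane_sym eq by (metis Pair_inject)
    next
      case 4
      then show ?thesis using H_monotoneD[OF mono _ _ h] by blast
    qed auto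
  qed
  ultimately show False
    using assms(1) unfolding maximal_H_monotone_def maximal_H_monotone_set_def by blast
qed

section \<open>Local boundedness of H-monotone maps\<close>

text \<open>
  For \<open>p\<close> near the unit there is a point \<open>q p\<close> on the horizontal planes of \<open>p\<close>, \<open>s1\<close> and \<open>s2\<close> whose
  projection lies inside the triangle of the projections of these three points (\<open>\<beta>1 p\<close>, \<open>\<beta>2 p\<close> are
  its barycentric coordinates, with limit \<open>1/4\<close>).  Hence \<open>xi1 (q p) - xi1 p\<close> is a positive combination
  of the \<open>xi1 s\<^sub>i - xi1 (q p)\<close>, and monotonicity from \<open>p\<close> to \<open>q p\<close> to \<open>s\<^sub>i\<close> bounds \<open>T p\<close> in that direction.
\<close>

lemma H_monotone_bounded_direction_unit:
  fixes T :: "'n::finite heis \<Rightarrow> 'n layer1 set" and u :: "'n layer1"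
  assumes mono: "H_monotone_set (set_map_graph T)" and dom: "\<And>p. T p \<noteq> {}"
    and u: "u \<noteq> 0" and d: "0 < d"
  shows "\<exists>C. \<forall>\<^sub>F p in nhds heis_unit. \<forall>v\<in>T p. u \<bullet> v \<le> C + d * norm v"
proof -
  \<comment> \<open>The sum \<open>a1 + a2\<close> is a multiple of \<open>u\<close>, while the
    \<open>rot u\<close> terms make \<open>symp a1 a2\<close> nonzero, so that \<open>a1\<close> and
    \<open>a2\<close> span a nondegenerate plane.\<close>
  define a1 where "a1 = 4 *\<^sub>R u + rot u"
  define a2 where "a2 = 4 *\<^sub>R u - rot u"
  define W0 where "W0 = symp a1 a2"
  have "W0 = - 8 * (norm u)\<^sup>2"
    using symp_swap[of u "rot u"] by (simp add: W0_def a1_def a2_def)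
  then have W0: "W0 \<noteq> 0" using u by simp
  \<comment> \<open>With these heights both coefficients \<open>\<beta>1\<close> and
    \<open>\<beta>2\<close> equal \<open>1/4\<close> at the unit.\<close>
  define s1 where "s1 = point a1 (- W0 / 2)"
  define s2 where "s2 = point a2 (W0 / 2)"
  obtain w1 w2 where w1: "w1 \<in> T s1" and w2: "w2 \<in> T s2" using dom by blast
  define b1 where "b1 p = a1 - xi1 p" for p
  define b2 where "b2 p = a2 - xi1 p" for p
  define W where "W p = symp (b1 p) (b2 p)" for p
  \<comment> \<open>Cramer's rule, with determinant \<open>W p\<close>, for the two linear
    conditions on \<open>h p\<close> that put \<open>q p\<close> on the horizontal planes of
    \<open>s1\<close> and \<open>s2\<close>.\<close>
  define \<beta>1 where "\<beta>1 p = (symp (b2 p) (xi1 p) - (height p - W0 / 2) / 2) / W p" for p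
  define \<beta>2 where "\<beta>2 p = ((height p + W0 / 2) / 2 - symp (b1 p) (xi1 p)) / W p" for p
  define h where "h p = \<beta>1 p *\<^sub>R b1 p + \<beta>2 p *\<^sub>R b2 p" for p
  define q where "q p = point (xi1 p + h p) (height p + 2 * symp (xi1 p) (h p))" for p
  \<comment> \<open>The factor tends to \<open>1/2\<close> and \<open>h p\<close> to
    \<open>2 *\<^sub>R u\<close>, so \<open>k p\<close> tends to \<open>u\<close>.\<close>
  define k where "k p = (1 - \<beta>1 p - \<beta>2 p) *\<^sub>R h p" for p
  define B where "B p = \<beta>1 p * ((b1 p - h p) \<bullet> w1) + \<beta>2 p * ((b2 p - h p) \<bullet> w2)" for p
  have xi0: "xi1 (heis_unit :: 'n heis) = 0" and ht0: "height (heis_unit :: 'n heis) = 0"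
    by (simp_all add: heis_unit_def height_def zero_prod_def)
  have id: "((\<lambda>p. p) \<longlongrightarrow> heis_unit) (nhds (heis_unit :: 'n heis))" by (simp add: filterlim_ident)
  note lims = tendsto_xi1[OF id, unfolded xi0] tendsto_height[OF id, unfolded ht0]
  have lb1: "(b1 \<longlongrightarrow> a1 - 0) (nhds heis_unit)" and lb2: "(b2 \<longlongrightarrow> a2 - 0) (nhds heis_unit)"
    unfolding b1_def b2_def by (intro tendsto_intros lims)+
  then have lb1: "(b1 \<longlongrightarrow> a1) (nhds heis_unit)" and lb2: "(b2 \<longlongrightarrow> a2) (nhds heis_unit)" by simp_all
  have lW: "(W \<longlongrightarrow> W0) (nhds heis_unit)"
    unfolding W_def W0_def by (intro tendsto_intros lb1 lb2)
  have s0: "symp x 0 = 0" for x :: "'n layer1" by (simp add: symp_def)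
  have "(\<beta>1 \<longlongrightarrow> (symp a2 0 - (0 - W0 / 2) / 2) / W0) (nhds heis_unit)"
    unfolding \<beta>1_def by (intro tendsto_intros lims lb2 lW W0) auto
  then have l1: "(\<beta>1 \<longlongrightarrow> 1/4) (nhds heis_unit)" using W0 s0 by simp
  have "(\<beta>2 \<longlongrightarrow> ((0 + W0 / 2) / 2 - symp a1 0) / W0) (nhds heis_unit)"
    unfolding \<beta>2_def by (intro tendsto_intros lims lb1 lW W0) auto
  then have l2: "(\<beta>2 \<longlongrightarrow> 1/4) (nhds heis_unit)" using W0 s0 by simp
  have "(h \<longlongrightarrow> (1/4) *\<^sub>R a1 + (1/4) *\<^sub>R a2) (nhds heis_unit)"
    unfolding h_def by (intro tendsto_intros lb1 lb2 l1 l2)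
  then have lh: "(h \<longlongrightarrow> 2 *\<^sub>R u) (nhds heis_unit)"
    by (simp add: a1_def a2_def algebra_simps scaleR_2 flip: scaleR_add_left)
  have "(k \<longlongrightarrow> (1 - 1/4 - 1/4) *\<^sub>R 2 *\<^sub>R u) (nhds heis_unit)"
    unfolding k_def by (intro tendsto_intros l1 l2 lh)
  then have lk: "(k \<longlongrightarrow> u) (nhds heis_unit)" by simp
  define B0 where "B0 = (1/4) * ((a1 - 2 *\<^sub>R u) \<bullet> w1) + (1/4) * ((a2 - 2 *\<^sub>R u) \<bullet> w2)"
  have "(B \<longlongrightarrow> B0) (nhds heis_unit)"
    unfolding B_def B0_def by (intro tendsto_intros l1 l2 lb1 lb2 lh)
  then have evB: "\<forall>\<^sub>F p in nhds heis_unit. B p < B0 + 1" by (rule order_tendstoD) simp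
  have evk: "\<forall>\<^sub>F p in nhds heis_unit. dist (k p) u < d" using lk d by (rule tendstoD)
  \<comment> \<open>Coefficients below \<open>1/2\<close> keep the factor
    \<open>1 - \<beta>1 p - \<beta>2 p\<close> of \<open>k p\<close> positive, so that monotonicity
    along \<open>h p\<close> carries over to \<open>k p\<close>.\<close>
  have ev1: "\<forall>\<^sub>F p in nhds heis_unit. 0 < \<beta>1 p \<and> \<beta>1 p < 1/2"
    using order_tendstoD[OF l1, of 0] order_tendstoD[OF l1, of "1/2"]
    by (simp add: eventually_conj_iff)
  have ev2: "\<forall>\<^sub>F p in nhds heis_unit. 0 < \<beta>2 p \<and> \<beta>2 p < 1/2"
    using order_tendstoD[OF l2, of 0] order_tendstoD[OF l2, of "1/2"]
    by (simp add: eventually_conj_iff)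
  have evW: "\<forall>\<^sub>F p in nhds heis_unit. W p \<noteq> 0"
    using tendsto_imp_eventually_ne[OF lW W0] .
  have "\<forall>\<^sub>F p in nhds heis_unit. \<forall>v\<in>T p. u \<bullet> v \<le> (B0 + 1) + d * norm v"
    using evB evk ev1 ev2 evW
  proof eventually_elim
    case (elim p)
    show ?case
    proof
      fix v assume v: "v \<in> T p"
      obtain w where w: "w \<in> T (q p)" using dom by blast
      have e2: "symp (b1 p) (xi1 p + h p) = (height p + W0 / 2) / 2"
        using elim(5) by (simp add: h_def \<beta>2_def W_def[symmetric])
      have "symp (b2 p) (xi1 p + h p) = symp (b2 p) (xi1 p) - \<beta>1 p * W p"
        by (simp add: h_def W_def symp_swap[of "b2 p" "b1 p"])
      then have e1: "symp (b2 p) (xi1 p + h p) = (height p - W0 / 2) / 2"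
        using elim(5) by (simp add: \<beta>1_def)
      have qs1: "q p \<in> horizontal_plane s1"
        using e2 by (simp add: horizontal_plane_iff q_def s1_def b1_def)
      have qs2: "q p \<in> horizontal_plane s2"
        using e1 by (simp add: horizontal_plane_iff q_def s2_def b2_def)
      have qp: "q p \<in> horizontal_plane p"
        by (simp add: horizontal_plane_iff q_def)
      have m: "h p \<bullet> v \<le> h p \<bullet> w"
        using H_monotoneD[OF mono v w qp] by (simp add: q_def inner_diff_right)
      have m1: "(b1 p - h p) \<bullet> w \<le> (b1 p - h p) \<bullet> w1"
        using H_monotoneD[OF mono w1 w qs1]
        by (simp add: q_def s1_def b1_def inner_diff_right algebra_simps)
      have m2: "(b2 p - h p) \<bullet> w \<le> (b2 p - h p) \<bullet> w2"
        using H_monotoneD[OF mono w2 w qs2]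
        by (simp add: q_def s2_def b2_def inner_diff_right algebra_simps)
      have keq: "k p = \<beta>1 p *\<^sub>R (b1 p - h p) + \<beta>2 p *\<^sub>R (b2 p - h p)"
      proof -
        have "k p = h p - \<beta>1 p *\<^sub>R h p - \<beta>2 p *\<^sub>R h p"
          by (simp add: k_def scaleR_diff_left)
        also have "\<dots> = (\<beta>1 p *\<^sub>R b1 p + \<beta>2 p *\<^sub>R b2 p) - \<beta>1 p *\<^sub>R h p - \<beta>2 p *\<^sub>R h p"
          by (subst (1) h_def) simp
        finally show ?thesis by (simp add: scaleR_diff_right)
      qed
      have "k p \<bullet> v \<le> k p \<bullet> w"
        unfolding k_def inner_scaleR_left using m elim(3,4) by (intro mult_left_mono) auto
      also have "\<dots> \<le> B p"
        unfolding keq B_def inner_add_left inner_scaleR_left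
        using m1 m2 elim(3,4) by (intro add_mono mult_left_mono) auto
      finally have "k p \<bullet> v \<le> B0 + 1" using elim(1) by simp
      \<comment> \<open>The bound so far concerns \<open>k p\<close>, which only approximates
        \<open>u\<close>; the difference produces the term \<open>d * norm v\<close>.\<close>
      moreover have "(u - k p) \<bullet> v \<le> d * norm v"
      proof -
        have "(u - k p) \<bullet> v \<le> norm (u - k p) * norm v" by (rule norm_cauchy_schwarz)
        also have "\<dots> \<le> d * norm v"
          using elim(2) by (intro mult_right_mono) (simp_all add: dist_norm norm_minus_commute)
        finally show ?thesis .
      qed
      ultimately show "u \<bullet> v \<le> (B0 + 1) + d * norm v" by (simp add: inner_diff_left)
    qed
  qed
  then show ?thesis by blast
qed

text \<open>Left translation by \<open>r\<close> preserves horizontal planes and differences of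
  projections, so \<open>T (heis_mult r p)\<close> is again H-monotone in \<open>p\<close>, and the
  case of the unit applies.\<close>

lemma H_monotone_bounded_direction:
  fixes T :: "'n::finite heis \<Rightarrow> 'n layer1 set" and u :: "'n layer1"
  assumes mono: "H_monotone_set (set_map_graph T)" and dom: "\<And>p. T p \<noteq> {}"
    and u: "u \<noteq> 0" and d: "0 < d"
  shows "\<exists>C. \<forall>\<^sub>F p in nhds r. \<forall>v\<in>T p. u \<bullet> v \<le> C + d * norm v"
proof -
  have "H_monotone_set (set_map_graph (\<lambda>p. T (heis_mult r p)))"
    unfolding H_monotone_set_def set_map_graph_def
  proof clarify
    fix p v q w assume "v \<in> T (heis_mult r p)" "w \<in> T (heis_mult r q)" "q \<in> horizontal_plane p"
    then show "0 \<le> (xi1 p - xi1 q) \<bullet> (v - w)"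
      using H_monotoneD[OF mono, of v "heis_mult r p" w "heis_mult r q"] by simp
  qed
  then obtain C where
    C: "\<forall>\<^sub>F p in nhds heis_unit. \<forall>v\<in>T (heis_mult r p). u \<bullet> v \<le> C + d * norm v"
    using H_monotone_bounded_direction_unit[of "\<lambda>p. T (heis_mult r p)"] dom u d by blast
  have "((\<lambda>p. heis_mult (heis_inv r) p) \<longlongrightarrow> heis_mult (heis_inv r) r) (nhds r)"
    unfolding heis_mult_eq_point by (intro tendsto_intros) (simp add: filterlim_ident)+
  then have "((\<lambda>p. heis_mult (heis_inv r) p) \<longlongrightarrow> heis_unit) (nhds r)" by simp
  from eventually_compose_filterlim[OF C this]
  show ?thesis by (auto simp flip: heis_mult_assoc)
qed

text \<open>The bounds in the directions of the basis vectors and their negatives add up to a bound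
  on the l1 norm.\<close>

lemma H_monotone_locally_bounded:
  fixes T :: "'n::finite heis \<Rightarrow> 'n layer1 set"
  assumes mono: "H_monotone_set (set_map_graph T)" and dom: "\<And>p. T p \<noteq> {}"
  shows "\<exists>M. \<forall>\<^sub>F p in nhds r. \<forall>v\<in>T p. norm v \<le> M"
proof -
  \<comment> \<open>Summed over the basis, the error terms amount to \<open>norm v / 2\<close>,
    which the left-hand side absorbs.\<close>
  define d :: real where "d = 1 / (2 * DIM('n layer1))"
  have d: "0 < d" by (simp add: d_def)
  define C where
    "C u = (SOME C. \<forall>\<^sub>F p in nhds r. \<forall>v\<in>T p. u \<bullet> v \<le> C + d * norm v)" for u
  have C: "\<forall>\<^sub>F p in nhds r. \<forall>v\<in>T p. u \<bullet> v \<le> C u + d * norm v" if "u \<noteq> 0" for u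
    unfolding C_def by (rule someI_ex) (rule H_monotone_bounded_direction[OF mono dom that d])
  have "\<forall>\<^sub>F p in nhds r. \<forall>b\<in>Basis. (\<forall>v\<in>T p. b \<bullet> v \<le> C b + d * norm v) \<and>
          (\<forall>v\<in>T p. - b \<bullet> v \<le> C (- b) + d * norm v)"
    by (intro eventually_ball_finite ballI eventually_conj C) auto
  then have "\<forall>\<^sub>F p in nhds r. \<forall>v\<in>T p. norm v \<le> 2 * (\<Sum>b\<in>Basis. max (C b) (C (- b)))"
  proof eventually_elim
    case (elim p)
    show ?case
    proof
      fix v assume v: "v \<in> T p"
      have "norm v \<le> (\<Sum>b\<in>Basis. \<bar>v \<bullet> b\<bar>)" by (rule norm_le_l1)
      also have "\<dots> \<le> (\<Sum>b\<in>Basis. max (C b) (C (- b)) + d * norm v)"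
      proof (rule sum_mono)
        fix b :: "'n layer1" assume "b \<in> Basis"
        then have "b \<bullet> v \<le> C b + d * norm v" "- b \<bullet> v \<le> C (- b) + d * norm v"
          using elim v by auto
        then show "\<bar>v \<bullet> b\<bar> \<le> max (C b) (C (- b)) + d * norm v"
          by (auto simp: inner_commute abs_le_iff)
      qed
      also have "\<dots> = (\<Sum>b\<in>Basis. max (C b) (C (- b))) + norm v / 2"
        by (simp add: sum.distrib d_def)
      finally show "norm v \<le> 2 * (\<Sum>b\<in>Basis. max (C b) (C (- b)))" by simp
    qed
  qed
  then show ?thesis by blast
qed

section \<open>Semicontinuity, separation and closed graph\<close>

text \<open>
  A point \<open>p\<close> near \<open>r\<close> is in general not on the horizontal plane of \<open>s\<close>; the detour goes through a
  point \<open>q p\<close> on both planes that tends to the midpoint of \<open>r\<close> and \<open>s\<close>.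
\<close>

lemma H_monotone_upper_semicontinuous:
  fixes T :: "'n::finite heis \<Rightarrow> 'n layer1 set"
  assumes mono: "H_monotone_set (set_map_graph T)" and dom: "\<And>p. T p \<noteq> {}"
    and s: "s \<in> horizontal_plane r" and v: "v \<in> T s" and e: "0 < e"
  shows "\<forall>\<^sub>F p in nhds r. \<forall>w\<in>T p. - e < (xi1 r - xi1 s) \<bullet> (w - v)"
proof (cases "xi1 r = xi1 s")
  case True
  then show ?thesis using e by simp
next
  case False
  define D where "D p = xi1 p - xi1 s" for p
  have D0: "D r \<noteq> 0" using False by (simp add: D_def)
  \<comment> \<open>For \<open>q p\<close> on the plane of \<open>p\<close>, lying on the plane of
    \<open>s\<close> means \<open>symp (D p) (z p) = (height s - height p) / 2\<close>. The
    correction along \<open>rot (D p)\<close> achieves this, and it vanishes at \<open>p = r\<close>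
    because \<open>s\<close> is horizontal to \<open>r\<close>.\<close>
  define \<kappa> where "\<kappa> p = ((height s - height p) / 2 - symp (xi1 p) (xi1 s)) / (norm (D p))\<^sup>2" for p
  define z where "z p = (1/2) *\<^sub>R (xi1 p + xi1 s) + \<kappa> p *\<^sub>R rot (D p)" for p
  define q where "q p = point (z p) (height p + 2 * symp (xi1 p) (z p))" for p
  have id: "((\<lambda>p. p) \<longlongrightarrow> r) (nhds r)" by (simp add: filterlim_ident)
  have lD: "(D \<longlongrightarrow> D r) (nhds r)" unfolding D_def by (intro tendsto_intros id)
  have "(\<kappa> \<longlongrightarrow> \<kappa> r) (nhds r)"
    unfolding \<kappa>_def using D0 by (intro tendsto_intros id lD) simp_all
  moreover have "\<kappa> r = 0" using s by (simp add: \<kappa>_def horizontal_plane_iff)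
  ultimately have l\<kappa>: "(\<kappa> \<longlongrightarrow> 0) (nhds r)" by simp
  have "(z \<longlongrightarrow> (1/2) *\<^sub>R (xi1 r + xi1 s) + 0 *\<^sub>R rot (D r)) (nhds r)"
    unfolding z_def by (intro tendsto_intros id lD l\<kappa>)
  then have lz: "(z \<longlongrightarrow> (1/2) *\<^sub>R (xi1 r + xi1 s)) (nhds r)" by simp
  define m where
    "m = point ((1/2) *\<^sub>R (xi1 r + xi1 s))
      (height r + 2 * symp (xi1 r) ((1/2) *\<^sub>R (xi1 r + xi1 s)))"
  have lq: "(q \<longlongrightarrow> m) (nhds r)"
    unfolding q_def m_def by (intro tendsto_intros id lz)
  obtain M where M: "\<forall>\<^sub>F p in nhds r. \<forall>v\<in>T p. norm v \<le> M"
    using H_monotone_locally_bounded[OF mono dom] by blast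
  obtain M' where "\<forall>\<^sub>F p in nhds m. \<forall>v\<in>T p. norm v \<le> M'"
    using H_monotone_locally_bounded[OF mono dom] by blast
  from eventually_compose_filterlim[OF this lq]
  have M': "\<forall>\<^sub>F p in nhds r. \<forall>v\<in>T (q p). norm v \<le> M'" .
  \<comment> \<open>\<open>D r \<bullet> (w - v)\<close> is split through a value \<open>y\<close>
    of \<open>T (q p)\<close>. On the two pieces \<open>D r\<close> is replaced by twice the step
    from \<open>z p\<close> to \<open>xi1 p\<close> and from \<open>xi1 s\<close> to
    \<open>z p\<close>; \<open>E p\<close> bounds the cost, and it tends to 0 since both doubled
    steps tend to \<open>D r\<close>.\<close>
  define E where "E p = norm (D r - 2 *\<^sub>R (xi1 p - z p)) * (M + M') +
      norm (D r - 2 *\<^sub>R (z p - xi1 s)) * (M' + norm v)" for p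
  have half: "D r - 2 *\<^sub>R (xi1 r - (1/2) *\<^sub>R (xi1 r + xi1 s)) = 0"
             "D r - 2 *\<^sub>R ((1/2) *\<^sub>R (xi1 r + xi1 s) - xi1 s) = 0"
    by (simp_all add: D_def algebra_simps scaleR_2)
  have "(E \<longlongrightarrow> norm (D r - 2 *\<^sub>R (xi1 r - (1/2) *\<^sub>R (xi1 r + xi1 s))) * (M + M') +
      norm (D r - 2 *\<^sub>R ((1/2) *\<^sub>R (xi1 r + xi1 s) - xi1 s)) * (M' + norm v)) (nhds r)"
    unfolding E_def by (intro tendsto_intros id lz)
  then have "(E \<longlongrightarrow> 0) (nhds r)" unfolding half by simp
  then have evE: "\<forall>\<^sub>F p in nhds r. E p < e" using e by (rule order_tendstoD)
  have evD: "\<forall>\<^sub>F p in nhds r. D p \<noteq> 0" using lD D0 by (rule tendsto_imp_eventually_ne)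
  show ?thesis using M M' evE evD
  proof eventually_elim
    case (elim p)
    show ?case
    proof
      fix w assume w: "w \<in> T p"
      obtain y where y: "y \<in> T (q p)" using dom by blast
      have qp: "q p \<in> horizontal_plane p" by (simp add: horizontal_plane_iff q_def)
      have "symp (D p) (z p) = symp (D p) ((1/2) *\<^sub>R (xi1 p + xi1 s)) + \<kappa> p * (norm (D p))\<^sup>2"
        by (simp only: z_def symp_linear symp_rot)
      also have "symp (D p) ((1/2) *\<^sub>R (xi1 p + xi1 s)) = symp (xi1 p) (xi1 s)"
        using symp_swap[of "xi1 p" "xi1 s"] by (simp add: D_def)
      also have "symp (xi1 p) (xi1 s) + \<kappa> p * (norm (D p))\<^sup>2 = (height s - height p) / 2"
        using elim(4) by (simp add: \<kappa>_def)
      finally have "s \<in> horizontal_plane (q p)"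
        unfolding horizontal_plane_sym[of s] by (simp add: horizontal_plane_iff q_def D_def)
      from H_monotoneD[OF mono y v this] H_monotoneD[OF mono w y qp]
      have "0 \<le> (z p - xi1 s) \<bullet> (y - v)" "0 \<le> (xi1 p - z p) \<bullet> (w - y)" by (simp_all add: q_def)
      moreover have "- (D r - 2 *\<^sub>R (xi1 p - z p)) \<bullet> (w - y)
          \<le> norm (D r - 2 *\<^sub>R (xi1 p - z p)) * (M + M')"
      proof -
        have "norm (w - y) \<le> M + M'" using norm_triangle_ineq4[of w y] elim(1,2) w y by force
        then show ?thesis
          using norm_cauchy_schwarz[of "- (D r - 2 *\<^sub>R (xi1 p - z p))" "w - y"]
          by (smt (verit) mult_left_mono norm_ge_zero norm_minus_cancel)
      qed
      moreover have "- (D r - 2 *\<^sub>R (z p - xi1 s)) \<bullet> (y - v)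
          \<le> norm (D r - 2 *\<^sub>R (z p - xi1 s)) * (M' + norm v)"
      proof -
        have "norm (y - v) \<le> M' + norm v" using norm_triangle_ineq4[of y v] elim(2) y by force
        then show ?thesis
          using norm_cauchy_schwarz[of "- (D r - 2 *\<^sub>R (z p - xi1 s))" "y - v"]
          by (smt (verit) mult_left_mono norm_ge_zero norm_minus_cancel)
      qed
      moreover have "D r \<bullet> (w - v) = (D r - 2 *\<^sub>R (xi1 p - z p)) \<bullet> (w - y)
          + (D r - 2 *\<^sub>R (z p - xi1 s)) \<bullet> (y - v)
          + 2 * ((xi1 p - z p) \<bullet> (w - y)) + 2 * ((z p - xi1 s) \<bullet> (y - v))"
        by (simp add: inner_simps algebra_simps)
      ultimately have "- E p \<le> D r \<bullet> (w - v)" unfolding E_def inner_minus_left by linarith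
      then show "- e < (xi1 r - xi1 s) \<bullet> (w - v)" using elim(3) by (simp add: D_def)
    qed
  qed
qed

text \<open>By maximality some \<open>w \<in> T s\<close> violates monotonicity against
  \<open>(r, v)\<close>; semicontinuity along \<open>xi1 r - xi1 s\<close> keeps nearby values on
  the side of \<open>w\<close>.\<close>

lemma maximal_H_monotone_separated:
  fixes T :: "'n::finite heis \<Rightarrow> 'n layer1 set"
  assumes max: "maximal_H_monotone T" and dom: "\<And>p. T p \<noteq> {}" and v: "v \<notin> T r"
  shows "\<exists>a b. a \<bullet> v < b \<and> (\<forall>\<^sub>F p in nhds r. \<forall>w\<in>T p. b < a \<bullet> w)"
proof -
  have mono: "H_monotone_set (set_map_graph T)"
    using max by (simp add: maximal_H_monotone_def maximal_H_monotone_set_def)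
  obtain s w where s: "s \<in> horizontal_plane r" "w \<in> T s" and neg: "(xi1 r - xi1 s) \<bullet> (v - w) < 0"
    using maximal_H_monotoneI[OF max, of r v] v by (meson not_le)
  define a where "a = xi1 r - xi1 s"
  \<comment> \<open>The tolerance is half the gap, which puts the threshold midway between
    \<open>a \<bullet> v\<close> and \<open>a \<bullet> w\<close>.\<close>
  have "\<forall>\<^sub>F p in nhds r. \<forall>w'\<in>T p. - (- (a \<bullet> (v - w)) / 2) < a \<bullet> (w' - w)"
    unfolding a_def using neg by (intro H_monotone_upper_semicontinuous[OF mono dom s]) simp
  then have "\<forall>\<^sub>F p in nhds r. \<forall>w'\<in>T p. a \<bullet> (v + w) / 2 < a \<bullet> w'"
    by (rule eventually_mono) (auto simp: inner_simps field_simps)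
  moreover have "a \<bullet> v < a \<bullet> (v + w) / 2"
    using neg by (simp add: a_def[symmetric] inner_simps)
  ultimately show ?thesis by blast
qed

text \<open>A limit \<open>(p, v)\<close> outside the graph would be strictly separated from all
  values near \<open>p\<close>, among them values converging to \<open>v\<close>.\<close>

lemma closed_maximal_H_monotone_graph:
  fixes T :: "'n::finite heis \<Rightarrow> 'n layer1 set"
  assumes max: "maximal_H_monotone T" and dom: "\<And>p. T p \<noteq> {}"
  shows "closed (set_map_graph T)"
  unfolding closed_sequential_limits
proof clarify
  fix X :: "nat \<Rightarrow> 'n heis \<times> 'n layer1" and p v
  assume X: "\<forall>i. X i \<in> set_map_graph T" and lim: "X \<longlonglongrightarrow> (p, v)"
  have l: "(\<lambda>i. fst (X i)) \<longlonglongrightarrow> p" "(\<lambda>i. snd (X i)) \<longlonglongrightarrow> v"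
    using tendsto_fst[OF lim] tendsto_snd[OF lim] by simp_all
  have "v \<in> T p"
  proof (rule ccontr)
    assume "v \<notin> T p"
    then obtain a b where ab: "a \<bullet> v < b" and ev: "\<forall>\<^sub>F q in nhds p. \<forall>w\<in>T q. b < a \<bullet> w"
      using maximal_H_monotone_separated[OF max dom] by blast
    have "\<forall>\<^sub>F i in sequentially. b < a \<bullet> snd (X i)"
      using eventually_compose_filterlim[OF ev l(1)]
      by (rule eventually_mono) (use X in \<open>auto simp: set_map_graph_def case_prod_beta\<close>)
    moreover have "(\<lambda>i. a \<bullet> snd (X i)) \<longlonglongrightarrow> a \<bullet> v" by (intro tendsto_intros l)
    then have "\<forall>\<^sub>F i in sequentially. a \<bullet> snd (X i) < b" using ab by (rule order_tendstoD)
    ultimately have "\<forall>\<^sub>F i in sequentially. False" by eventually_elim simp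
    then show False by simp
  qed
  then show "(p, v) \<in> set_map_graph T" by (simp add: set_map_graph_def)
qed

section \<open>Closedness, nonemptiness and Lipschitz continuity of the resolvent\<close>

lemma resolvent_iff:
  assumes l: "0 < l"
  shows "p \<in> resolvent l T v \<longleftrightarrow> (1 / l) *\<^sub>R (v - xi1 p) \<in> T p"
proof -
  have "v = xi1 p + l *\<^sub>R w \<longleftrightarrow> w = (1 / l) *\<^sub>R (v - xi1 p)" for w
    using l by auto
  then show ?thesis unfolding resolvent_def mem_Collect_eq by metis
qed

lemma closed_resolvent:
  fixes T :: "'n::finite heis \<Rightarrow> 'n layer1 set"
  assumes max: "maximal_H_monotone T" and dom: "\<And>p. T p \<noteq> {}" and l: "0 < l"
  shows "closed (resolvent l T v)"
proof -
  have "resolvent l T v = (\<lambda>p. (p, (1 / l) *\<^sub>R (v - xi1 p))) -` set_map_graph T"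
    by (intro set_eqI) (simp add: set_map_graph_def resolvent_iff[OF l])
  moreover have "closed ((\<lambda>p. (p, (1 / l) *\<^sub>R (v - xi1 p))) -` set_map_graph T)"
    using closed_maximal_H_monotone_graph[OF max dom]
    unfolding xi1_eq by (intro closed_vimage continuous_intros)
  ultimately show ?thesis by simp
qed

lemma resolvent_horizontal:
  fixes T :: "'n::finite heis \<Rightarrow> 'n layer1 set"
  assumes max: "maximal_H_monotone T" and dom: "\<And>p. T p \<noteq> {}" and l: "0 < l"
    and r: "r \<in> resolvent l T v'"
  shows "\<exists>p\<in>resolvent l T v. p \<in> horizontal_plane r \<and> norm (xi1 r - xi1 p) \<le> norm (v' - v)"
proof -
  have mono: "H_monotone_set (set_map_graph T)"
    using max by (simp add: maximal_H_monotone_def maximal_H_monotone_set_def)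
  obtain w' where w': "w' \<in> T r" and v': "v' = xi1 r + l *\<^sub>R w'"
    using r by (auto simp: resolvent_def)
  define \<tau> where "\<tau> z = point z (height r + 2 * symp (xi1 r) z)" for z
  have \<tau>: "\<tau> z \<in> horizontal_plane r" "xi1 (\<tau> z) = z" for z
    by (simp_all add: \<tau>_def horizontal_plane_iff)
  define G where "G z = (\<lambda>w. z + l *\<^sub>R w - v) ` T (\<tau> z)" for z
  \<comment> \<open>Every \<open>\<tau> z\<close> is horizontal to \<open>r\<close>, so monotonicity
    is available against the pair \<open>(r, w')\<close>, although two points
    \<open>\<tau> z\<close> need not be horizontal to each other.\<close>
  have coercive: "(norm (z - xi1 r))\<^sup>2 - norm (z - xi1 r) * norm (v' - v) \<le> (z - xi1 r) \<bullet> g"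
    if g_in: "g \<in> G z" for z g
  proof -
    obtain w where w: "w \<in> T (\<tau> z)" and g: "g = z + l *\<^sub>R w - v" using g_in unfolding G_def by blast
    have "0 \<le> (xi1 r - z) \<bullet> (w' - w)" using H_monotoneD[OF mono w' w \<tau>(1)] \<tau>(2) by simp
    then have "0 \<le> (z - xi1 r) \<bullet> (w - w')" by (simp add: inner_simps)
    then have "0 \<le> l * ((z - xi1 r) \<bullet> (w - w'))" using l by (intro mult_nonneg_nonneg) auto
    moreover have "(z - xi1 r) \<bullet> g =
        (z - xi1 r) \<bullet> (z - xi1 r) + l * ((z - xi1 r) \<bullet> (w - w')) + (z - xi1 r) \<bullet> (v' - v)"
      unfolding g v' by (simp add: inner_simps algebra_simps)
    moreover have "- (norm (z - xi1 r) * norm (v' - v)) \<le> (z - xi1 r) \<bullet> (v' - v)"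
      using Cauchy_Schwarz_ineq2[of "z - xi1 r" "v' - v"] by linarith
    ultimately show ?thesis by (simp add: power2_norm_eq_inner)
  qed
  \<comment> \<open>At distance \<open>N + 1\<close>, with \<open>N = norm (v' - v)\<close>, the
    coercivity bound equals \<open>N + 1\<close>, so the values point strictly outward on the
    sphere.\<close>
  have "\<exists>z\<in>cball (xi1 r) (norm (v' - v) + 1). 0 \<in> G z"
  proof (rule coercive_set_map_zero)
    show "0 < norm (v' - v) + 1" by (simp add: add_nonneg_pos)
    show "G z \<noteq> {}" for z using dom by (simp add: G_def)
    show "0 < (z - xi1 r) \<bullet> g" if "dist (xi1 r) z = norm (v' - v) + 1" and "g \<in> G z" for z g
    proof -
      define N where "N = norm (v' - v)"
      have "norm (z - xi1 r) = N + 1" using that(1) by (simp add: dist_norm norm_minus_commute N_def)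
      with coercive[OF that(2)] have "(N + 1)\<^sup>2 - (N + 1) * N \<le> (z - xi1 r) \<bullet> g"
        by (simp add: N_def)
      moreover have "(N + 1)\<^sup>2 - (N + 1) * N = N + 1" by (simp add: power2_eq_square algebra_simps)
      moreover have "0 \<le> N" by (simp add: N_def)
      ultimately show ?thesis by linarith
    qed
    fix z assume "0 \<notin> G z"
    then have "(1 / l) *\<^sub>R (v - z) \<notin> T (\<tau> z)"
      using l by (auto simp: G_def image_iff)
    then obtain a b where ab: "a \<bullet> ((1 / l) *\<^sub>R (v - z)) < b"
      and ev: "\<forall>\<^sub>F p in nhds (\<tau> z). \<forall>w\<in>T p. b < a \<bullet> w"
      using maximal_H_monotone_separated[OF max dom] by blast
    have "(\<tau> \<longlongrightarrow> \<tau> z) (nhds z)"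
      unfolding \<tau>_def by (intro tendsto_intros) (simp_all add: filterlim_ident)
    from eventually_compose_filterlim[OF ev this]
    have ev1: "\<forall>\<^sub>F z' in nhds z. \<forall>w\<in>T (\<tau> z'). b < a \<bullet> w" .
    \<comment> \<open>The vector to be separated from \<open>T (\<tau> z')\<close> moves with
      \<open>z'\<close>; by continuity it stays below the threshold \<open>b\<close>.\<close>
    have "((\<lambda>z'. a \<bullet> ((1 / l) *\<^sub>R (v - z'))) \<longlongrightarrow> a \<bullet> ((1 / l) *\<^sub>R (v - z))) (nhds z)"
      by (intro tendsto_intros) (simp add: filterlim_ident)
    then have ev2: "\<forall>\<^sub>F z' in nhds z. a \<bullet> ((1 / l) *\<^sub>R (v - z')) < b"
      using ab by (rule order_tendstoD)
    have "\<forall>\<^sub>F z' in nhds z. \<forall>g\<in>G z'. 0 < a \<bullet> g"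
      using ev1 ev2
    proof eventually_elim
      case (elim z')
      show ?case
      proof
        fix g assume "g \<in> G z'"
        then obtain w where w: "w \<in> T (\<tau> z')" and g: "g = z' + l *\<^sub>R w - v"
          unfolding G_def by blast
        have "g = l *\<^sub>R (w - (1 / l) *\<^sub>R (v - z'))"
          using l by (simp add: g scaleR_diff_right)
        moreover have "0 < l * (a \<bullet> w - a \<bullet> ((1 / l) *\<^sub>R (v - z')))"
          using elim w l by (intro mult_pos_pos) force+
        ultimately show "0 < a \<bullet> g" by (simp only: inner_scaleR_right inner_diff_right)
      qed
    qed
    then show "\<exists>a. \<forall>\<^sub>F z' in nhds z. \<forall>g\<in>G z'. 0 < a \<bullet> g" by blast
  qed
  then obtain z where z: "0 \<in> G z" by blast
  then obtain w where "w \<in> T (\<tau> z)" "0 = z + l *\<^sub>R w - v" unfolding G_def by blast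
  then have "w \<in> T (\<tau> z)" "v = xi1 (\<tau> z) + l *\<^sub>R w" by (simp_all add: \<tau>(2))
  then have "\<tau> z \<in> resolvent l T v" unfolding resolvent_def by blast
  moreover have "norm (xi1 r - xi1 (\<tau> z)) \<le> norm (v' - v)"
  proof -
    \<comment> \<open>Coercivity at the value \<open>0\<close> of \<open>G z\<close>.\<close>
    have "norm (z - xi1 r) * norm (z - xi1 r) \<le> norm (z - xi1 r) * norm (v' - v)"
      using coercive[OF z] by (simp add: power2_eq_square)
    then have "norm (z - xi1 r) \<le> norm (v' - v)"
      by (cases "z = xi1 r") (simp_all add: mult_le_cancel_left)
    then show ?thesis by (simp add: \<tau>(2) norm_minus_commute)
  qed
  ultimately show ?thesis using \<tau>(1) by blast
qed

text \<open>Horizontality gives \<open>heis_mult (heis_inv p) r\<close> height 0, and there the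
  gauge is the Euclidean norm of the projection.\<close>

lemma horizontal_set_mult_cball:
  assumes "p \<in> A" "p \<in> horizontal_plane r" "norm (xi1 r - xi1 p) \<le> k"
  shows "r \<in> heis_set_mult A (heis_cball heis_unit k)"
proof -
  define b where "b = heis_mult (heis_inv p) r"
  have sm: "symp (- xi1 p) (xi1 r) = symp (xi1 r) (xi1 p)"
    by (simp add: symp_def inner_commute)
  have "height b = 0"
    using assms(2) sm by (simp add: b_def horizontal_plane_iff)
  then have "heis_dist heis_unit b = root 4 ((norm (xi1 r - xi1 p)) ^ 4)"
    by (simp add: heis_dist_def heis_gauge_eq b_def norm_minus_commute)
  also have "\<dots> = norm (xi1 r - xi1 p)" by (simp add: real_root_power_cancel)
  finally have "b \<in> heis_cball heis_unit k" using assms(3) by (simp add: heis_cball_def)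
  moreover have "r = heis_mult p b" by (simp add: b_def flip: heis_mult_assoc)
  ultimately show ?thesis using assms(1) unfolding heis_set_mult_def by blast
qed

theorem proposition4p1:
  fixes T :: "'n::finite heis \<Rightarrow> 'n layer1 set"
  assumes "maximal_H_monotone T"
    and "set_map_dom T = UNIV"
  shows "\<forall>l::real. l > 0 \<longrightarrow> Hausdorff_lipschitz 1 (resolvent l T)"
proof (intro allI impI)
  fix l :: real assume l: "l > 0"
  have dom: "T p \<noteq> {}" for p using assms(2) by (auto simp: set_map_dom_def)
  note horizontal = resolvent_horizontal[OF assms(1) dom l]
  \<comment> \<open>One nonempty resolvent value is enough: \<open>horizontal\<close> carries a
    point of it to every other \<open>v\<close>.\<close>
  obtain w where "w \<in> T heis_unit" using dom by blast
  then have "heis_unit \<in> resolvent l T (xi1 heis_unit + l *\<^sub>R w)"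
    unfolding resolvent_def by blast
  then have "resolvent l T v \<noteq> {}" for v using horizontal by blast
  moreover have "resolvent l T v' \<subseteq>
      heis_set_mult (resolvent l T v) (heis_cball heis_unit (norm (v' - v)))" for v v'
    using horizontal horizontal_set_mult_cball by blast
  ultimately show "Hausdorff_lipschitz 1 (resolvent l T)"
    using closed_resolvent[OF assms(1) dom l] by (simp add: Hausdorff_lipschitz_def)
qed

end
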